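(* Let $\mathcal{T}$ be a complete infinitely distributive lattice with a De Morgan complement, let $P$ be an annotated revision program over a set of atoms $U$ with annotations in $\mathcal{T}$, and let the $\mathcal{T}^2$-valuation $B_I$ be a consistent model of $P$. Then $B_I$ is the only $P$-justified revision of itself (i.e. $B_I$ is a $P$-justified revision of $B_I$, and every $P$-justified revision of $B_I$ equals $B_I$).
   Context: Lattice: $\mathcal{T}$ is a complete lattice with order $\le$, operations $\wedge,\vee$, bottom $\bot$, top $\top$, satisfying both infinite distributive laws ($a\vee\bigwedge S=\bigwedge_{s\in S}(a\vee s)$ and $a\wedge\bigvee S=\bigvee_{s\in S}(a\wedge s)$), with a De Morgan complement $\alpha\mapsto\overline{\alpha}$ (an order-reversing involution). Programs: $U$ is a set of atoms. Revision atoms are the formal expressions $\mathbf{in}(a)$, $\mathbf{out}(a)$, $a\in U$. An annotated revision atom is $(l:\alpha)$ with $l$ a revision atom and $\alpha\in\mathcal{T}$. An annotated revision rule is $p\leftarrow q_1,\dots,q_n$ ($n\ge 0$) with $p$ (head) and $q_1,\dots,q_n$ (body) annotated revision atoms. An annotated revision program is a set of such rules. Valuations: $\mathcal{T}^2=\mathcal{T}\times\mathcal{T}$ is ordered by $\langle\alpha_1,\beta_1\rangle\le_k\langle\alpha_2,\beta_2\rangle$ iff $\alpha_1\le\alpha_2$ and $\beta_1\le\beta_2$; its meet and join are $\otimes,\oplus$. Conflation is $-\langle\alpha,\beta\rangle=\langle\overline{\beta},\overline{\alpha}\rangle$. A $\mathcal{T}^2$-valuation is a map $B:U\to\mathcal{T}^2$;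 $\le_k,\otimes,\oplus,-$ are extended pointwise. $B$ is consistent if $B\le_k -B$. If $B(a)=\langle\alpha,\beta\rangle$, write $B[\mathbf{in}(a)]=\alpha$, $B[\mathbf{out}(a)]=\beta$. $B$ satisfies $(l:\alpha)$ if $\alpha\le B[l]$, and satisfies a body if it satisfies each of its members. $B$ is a model of $P$ if, for every rule of $P$, $B$ satisfies the head whenever it satisfies the body. Operator and necessary change: $T_P^b(B)$ is the $\mathcal{T}^2$-valuation with $T_P^b(B)[l]=\bigvee\{\alpha : (l:\alpha)$ is the head of a rule of $P$ whose body is satisfied by $B\}$ for each revision atom $l$. It is $\le_k$-monotone; its least fixpoint is the necessary change $NC(P)$. Justified revisions: $\mathit{pcomp}(\alpha,\beta)$ is the least $\gamma\in\mathcal{T}$ with $\alpha\vee\gamma\ge\beta$. The reduct $P_{B_R}|B_I$ is obtained from $P$ by (1) removing every rule whose body contains an annotated revision atom not satisfied by $B_R$, and (2) replacing each $(l:\beta)$ in the body of each remaining rule by $(l:\mathit{pcomp}(B_I[l],\beta))$. $B_R$ is a $P$-justified revision of $B_I$ if $B_R=(B_I\otimes -C)\oplus C$ where $C=NC(P_{B_R}|B_I)$. *)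

theory Defs
  imports Main "HOL-Library.Product_Order"
begin

text \<open>The library class \<open>complete_distrib_lattice\<close> demands complete distributivity, which is
  stronger than the two infinite distributive laws, hence a class of its own.\<close>

class de_morgan_lattice = complete_lattice +
  fixes dm :: "'a \<Rightarrow> 'a"
  assumes sup_Inf_distrib: "sup a (Inf S) = (INF s\<in>S. sup a s)"
    and inf_Sup_distrib: "inf a (Sup S) = (SUP s\<in>S. inf a s)"
    and dm_antimono: "a \<le> b \<Longrightarrow> dm b \<le> dm a"
    and dm_involution: "dm (dm a) = a"

datatype 'u revision_atom = In 'u | Out 'u

type_synonym ('u, 't) annotated_atom = "'u revision_atom \<times> 't"

datatype ('u, 't) revision_rule =
  Rule (rule_head: "('u, 't) annotated_atom") (rule_body: "('u, 't) annotated_atom list")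

type_synonym ('u, 't) revision_program = "('u, 't) revision_rule set"

text \<open>By \<open>HOL-Library.Product_Order\<close> the pair type is ordered componentwise, so on valuations
  \<open>\<le>\<close>, \<open>inf\<close> and \<open>sup\<close> are the knowledge ordering and its meet and join.\<close>

type_synonym ('u, 't) valuation = "'u \<Rightarrow> 't \<times> 't"

definition conflation :: "('u, 't::de_morgan_lattice) valuation \<Rightarrow> ('u, 't) valuation" where
  "conflation B = (\<lambda>a. (dm (snd (B a)), dm (fst (B a))))"

definition consistent :: "('u, 't::de_morgan_lattice) valuation \<Rightarrow> bool" where
  "consistent B \<longleftrightarrow> B \<le> conflation B"

fun val_at :: "('u, 't) valuation \<Rightarrow> 'u revision_atom \<Rightarrow> 't" where
  "val_at B (In a) = fst (B a)"
| "val_at B (Out a) = snd (B a)"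

definition satisfies :: "('u, 't::de_morgan_lattice) valuation \<Rightarrow> ('u, 't) annotated_atom \<Rightarrow> bool" where
  "satisfies B q \<longleftrightarrow> snd q \<le> val_at B (fst q)"

definition satisfies_body ::
    "('u, 't::de_morgan_lattice) valuation \<Rightarrow> ('u, 't) annotated_atom list \<Rightarrow> bool" where
  "satisfies_body B qs \<longleftrightarrow> (\<forall>q\<in>set qs. satisfies B q)"

definition is_model :: "('u, 't::de_morgan_lattice) revision_program \<Rightarrow> ('u, 't) valuation \<Rightarrow> bool" where
  "is_model P B \<longleftrightarrow>
     (\<forall>r\<in>P. satisfies_body B (rule_body r) \<longrightarrow> satisfies B (rule_head r))"

definition derived :: "('u, 't::de_morgan_lattice) revision_program \<Rightarrow> ('u, 't) valuation \<Rightarrow>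
    'u revision_atom \<Rightarrow> 't" where
  "derived P B l = Sup {\<alpha>. \<exists>r\<in>P. rule_head r = (l, \<alpha>) \<and> satisfies_body B (rule_body r)}"

definition T_op :: "('u, 't::de_morgan_lattice) revision_program \<Rightarrow> ('u, 't) valuation \<Rightarrow>
    ('u, 't) valuation" where
  "T_op P B = (\<lambda>a. (derived P B (In a), derived P B (Out a)))"

definition necessary_change :: "('u, 't::de_morgan_lattice) revision_program \<Rightarrow> ('u, 't) valuation" where
  "necessary_change P = lfp (T_op P)"

definition pcomp :: "'t::de_morgan_lattice \<Rightarrow> 't \<Rightarrow> 't" where
  "pcomp \<alpha> \<beta> = (LEAST \<gamma>. \<beta> \<le> sup \<alpha> \<gamma>)"

definition reduct :: "('u, 't::de_morgan_lattice) revision_program \<Rightarrow> ('u, 't) valuation \<Rightarrow>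
    ('u, 't) valuation \<Rightarrow> ('u, 't) revision_program" where
  "reduct P B\<^sub>R B\<^sub>I =
     {Rule (rule_head r) (map (\<lambda>(l, \<beta>). (l, pcomp (val_at B\<^sub>I l) \<beta>)) (rule_body r)) |r.
        r \<in> P \<and> satisfies_body B\<^sub>R (rule_body r)}"

definition justified_revision :: "('u, 't::de_morgan_lattice) revision_program \<Rightarrow>
    ('u, 't) valuation \<Rightarrow> ('u, 't) valuation \<Rightarrow> bool" where
  "justified_revision P B\<^sub>I B\<^sub>R \<longleftrightarrow>
     (let C = necessary_change (reduct P B\<^sub>R B\<^sub>I)
      in B\<^sub>R = sup (inf B\<^sub>I (conflation C)) C)"

text \<open>The operators \<open>lfp\<close> and \<open>LEAST\<close> are total in HOL; the following facts show that here
  they denote an actual least fixpoint and an actual least element.\<close>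

lemma val_at_mono:
  fixes B B' :: "('u, 't::de_morgan_lattice) valuation"
  assumes "B \<le> B'"
  shows "val_at B l \<le> val_at B' l"
  using assms by (cases l) (auto simp: le_fun_def less_eq_prod_def)

lemma T_op_mono:
  fixes P :: "('u, 't::de_morgan_lattice) revision_program"
  shows "mono (T_op P)"
proof (rule monoI)
  fix B B' :: "('u, 't) valuation"
  assume "B \<le> B'"
  then have "satisfies_body B qs \<Longrightarrow> satisfies_body B' qs" for qs
    unfolding satisfies_body_def satisfies_def by (meson order_trans val_at_mono)
  then have "derived P B l \<le> derived P B' l" for l
    unfolding derived_def by (intro Sup_subset_mono) blast
  then show "T_op P B \<le> T_op P B'"
    by (simp add: T_op_def le_fun_def less_eq_prod_def)
qed

lemma necessary_change_fixpoint: "T_op P (necessary_change P) = necessary_change P"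
  unfolding necessary_change_def by (rule lfp_fixpoint[OF T_op_mono])

lemma necessary_change_least: "T_op P B \<le> B \<Longrightarrow> necessary_change P \<le> B"
  unfolding necessary_change_def by (rule lfp_lowerbound)

lemma pcomp_eq_Inf: "pcomp \<alpha> \<beta> = Inf {\<gamma>. \<beta> \<le> sup \<alpha> \<gamma>}"
  unfolding pcomp_def
  by (rule Least_equality) (auto simp: sup_Inf_distrib intro: INF_greatest Inf_lower)

lemma le_sup_pcomp: "\<beta> \<le> sup \<alpha> (pcomp \<alpha> \<beta>)"
  by (auto simp: pcomp_eq_Inf sup_Inf_distrib intro: INF_greatest)

lemma pcomp_least: "\<beta> \<le> sup \<alpha> \<gamma> \<Longrightarrow> pcomp \<alpha> \<beta> \<le> \<gamma>"
  by (auto simp: pcomp_eq_Inf intro: Inf_lower)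

end

theory Submission
  imports Defs
begin

text \<open>If \<open>pcomp \<alpha> \<beta> \<le> \<alpha>\<close> then \<open>\<beta> \<le> \<alpha>\<close>, so a model \<open>B\<^sub>I\<close> of \<open>P\<close> is a model of every reduct
  \<open>P\<^sub>B|B\<^sub>I\<close>, whatever \<open>B\<close> is. Hence the necessary change \<open>C\<close> of the reduct is below \<open>B\<^sub>I\<close>, and
  consistency gives \<open>B\<^sub>I \<le> -B\<^sub>I \<le> -C\<close>. Revising \<open>B\<^sub>I\<close> by \<open>C\<close> therefore always returns \<open>B\<^sub>I\<close>.\<close>

lemma conflation_antimono: "B \<le> B' \<Longrightarrow> conflation B' \<le> conflation B"
  by (auto simp: conflation_def le_fun_def less_eq_prod_def intro: dm_antimono)

text \<open>The join of \<alpha> with \<open>pcomp \<alpha> \<beta>\<close> always reaches \<beta>,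
  and here that join collapses to \<alpha>.\<close>

lemma le_if_pcomp_le: "pcomp \<alpha> \<beta> \<le> \<alpha> \<Longrightarrow> \<beta> \<le> \<alpha>"
  using le_sup_pcomp[of \<beta> \<alpha>] by (simp add: sup_absorb1)

lemma is_model_reduct:
  assumes "is_model P B\<^sub>I"
  shows "is_model (reduct P B B\<^sub>I) B\<^sub>I"
proof -
  \<comment> \<open>Deleting rules and keeping heads is harmless for a model; only the weakened
    bodies need an argument.\<close>
  have "satisfies_body B\<^sub>I qs"
    if "satisfies_body B\<^sub>I (map (\<lambda>(l, \<beta>). (l, pcomp (val_at B\<^sub>I l) \<beta>)) qs)" for qs
    using that by (fastforce simp: satisfies_body_def satisfies_def intro: le_if_pcomp_le)
  then show ?thesis
    using assms by (auto simp: is_model_def reduct_def)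
qed

text \<open>A model bounds every head annotation that \<open>derived\<close> joins, so it is a
  pre-fixpoint of \<open>T_op P\<close>.\<close>

lemma necessary_change_le_model:
  assumes "is_model P B"
  shows "necessary_change P \<le> B"
proof -
  have "derived P B l \<le> val_at B l" for l
    using assms unfolding derived_def is_model_def satisfies_def
    by (fastforce intro: Sup_least)
  from this[of "In _"] this[of "Out _"] have "T_op P B \<le> B"
    by (simp add: T_op_def le_fun_def less_eq_prod_def)
  then show ?thesis
    by (rule necessary_change_least)
qed

theorem theorem5p11:
  fixes P :: "('u, 't::de_morgan_lattice) revision_program"
    and B\<^sub>I :: "('u, 't) valuation"
  assumes "consistent B\<^sub>I"
    and "is_model P B\<^sub>I"
  shows "justified_revision P B\<^sub>I B\<^sub>I \<and>
         (\<forall>B\<^sub>R. justified_revision P B\<^sub>I B\<^sub>R \<longrightarrow> B\<^sub>R = B\<^sub>I)"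
proof -
  \<comment> \<open>Leaving \<open>B\<^sub>R\<close> arbitrary serves both halves: the instance
    \<open>B\<^sub>I\<close> gives existence, the general case uniqueness.\<close>
  have "sup (inf B\<^sub>I (conflation C)) C = B\<^sub>I"
    if "C = necessary_change (reduct P B\<^sub>R B\<^sub>I)" for B\<^sub>R C
  proof -
    have C: "C \<le> B\<^sub>I"
      unfolding that by (intro necessary_change_le_model is_model_reduct assms)
    have "B\<^sub>I \<le> conflation B\<^sub>I"
      using assms(1) by (simp add: consistent_def)
    also have "\<dots> \<le> conflation C"
      using C by (rule conflation_antimono)
    finally show ?thesis
      using C by (simp add: inf_absorb1 sup_absorb1)
  qed
  then show ?thesis
    by (simp add: justified_revision_def Let_def)
qed

end
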